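(* Let $\{X_k, k\in\mathbb{N}\}$ be a standardized Gaussian process. Assume that its dependence measure satisfies $$\lim_{n\to\infty}\frac{\Delta(n)}{n^2}=0.$$ Then $$\sup_{t\in\mathbb{R}}\left|\widehat{F}_n(t)-\mathbf{E}\widehat{F}_n(t)\right|\xrightarrow{P}0\quad\text{as } n\to\infty,$$ where $\xrightarrow{P}$ denotes convergence in probability.
   Context: Here $\mathbb{N}=\{1,2,3,\dots\}$. A stochastic process $\{X_k,k\in\mathbb{N}\}$ of real random variables on a common probability space is a Gaussian process if for every finite set of indices $\{k_1,\dots,k_m\}$, $m\ge 1$, the joint distribution of $(X_{k_1},\dots,X_{k_m})$ is multivariate Gaussian (possibly degenerate). It is a standardized Gaussian process if in addition $X_k\sim\mathcal{N}(0,1)$ for every $k\in\mathbb{N}$. Let $\Phi$ be the cumulative distribution function of the standard Gaussian $\mathcal{N}(0,1)$. The empirical distribution is $$\widehat{F}_n(t)=\frac1n\sum_{i=1}^n\mathbf{1}(\Phi(X_i)\le t),\qquad t\in\mathbb{R},$$ where $\mathbf{1}(A)$ is the indicator of the event $A$. The dependence measure is $$\Delta(n)=2\sum_{1\le i<j\le n}|\mathrm{Cov}(X_i,X_j)|.$$ *)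

theory Defs
  imports "HOL-Probability.Probability"
begin

(* The normal laws N(m, s^2) on the real line with s \<ge> 0. The case s = 0 is the point mass at m;
   it has to be listed separately because normal_density m 0 is identically 0. *)
definition gaussian_law :: "real measure \<Rightarrow> bool" where
  "gaussian_law N \<longleftrightarrow>
     (\<exists>m. N = return borel m) \<or> (\<exists>m s. s > 0 \<and> N = density lborel (normal_density m s))"

(* N is a law on R^J, for a finite index set J. It is multivariate Gaussian, possibly degenerate,
   if every linear functional has a (possibly degenerate) normal law under N. *)
definition multivariate_gaussian_law :: "'i set \<Rightarrow> ('i \<Rightarrow> real) measure \<Rightarrow> bool" where
  "multivariate_gaussian_law J N \<longleftrightarrow>
     finite J \<and> sets N = sets (Pi\<^sub>M J (\<lambda>_. borel)) \<and>
     (\<forall>a :: 'i \<Rightarrow> real. gaussian_law (distr N borel (\<lambda>x. \<Sum>i\<in>J. a i * x i)))"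

(* Processes are indexed by {1, 2, 3, ...}: the value X 0 is never used. *)
definition gaussian_process :: "'a measure \<Rightarrow> (nat \<Rightarrow> 'a \<Rightarrow> real) \<Rightarrow> bool" where
  "gaussian_process M X \<longleftrightarrow>
     (\<forall>k\<ge>1. X k \<in> borel_measurable M) \<and>
     (\<forall>J. finite J \<longrightarrow> J \<noteq> {} \<longrightarrow> J \<subseteq> {1..} \<longrightarrow>
        multivariate_gaussian_law J (distr M (Pi\<^sub>M J (\<lambda>_. borel)) (\<lambda>\<omega>. \<lambda>i\<in>J. X i \<omega>)))"

definition standardized_gaussian_process :: "'a measure \<Rightarrow> (nat \<Rightarrow> 'a \<Rightarrow> real) \<Rightarrow> bool" where
  "standardized_gaussian_process M X \<longleftrightarrow>
     gaussian_process M X \<and> (\<forall>k\<ge>1. distr M borel (X k) = std_normal_distribution)"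

definition std_normal_cdf :: "real \<Rightarrow> real" where
  "std_normal_cdf = cdf std_normal_distribution"

definition empirical_distribution :: "(nat \<Rightarrow> 'a \<Rightarrow> real) \<Rightarrow> nat \<Rightarrow> real \<Rightarrow> 'a \<Rightarrow> real" where
  "empirical_distribution X n t \<omega> =
     (\<Sum>i=1..n. of_bool (std_normal_cdf (X i \<omega>) \<le> t)) / real n"

definition covariance :: "'a measure \<Rightarrow> ('a \<Rightarrow> real) \<Rightarrow> ('a \<Rightarrow> real) \<Rightarrow> real" where
  "covariance M Y Z =
     (\<integral>\<omega>. (Y \<omega> - (\<integral>\<omega>'. Y \<omega>' \<partial>M)) * (Z \<omega> - (\<integral>\<omega>'. Z \<omega>' \<partial>M)) \<partial>M)"

definition dependence_measure :: "'a measure \<Rightarrow> (nat \<Rightarrow> 'a \<Rightarrow> real) \<Rightarrow> nat \<Rightarrow> real" where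
  "dependence_measure M X n =
     2 * (\<Sum>(i, j)\<in>{(i, j). 1 \<le> i \<and> i < j \<and> j \<le> n}. \<bar>covariance M (X i) (X j)\<bar>)"

(* Measurability is part of the definition: otherwise a non-measurable event, to which
   "measure" assigns the value 0, would satisfy the limit condition vacuously. *)
definition converges_in_probability ::
    "'a measure \<Rightarrow> (nat \<Rightarrow> 'a \<Rightarrow> real) \<Rightarrow> ('a \<Rightarrow> real) \<Rightarrow> bool" where
  "converges_in_probability M Y Z \<longleftrightarrow>
     (\<forall>n. Y n \<in> borel_measurable M) \<and> Z \<in> borel_measurable M \<and>
     (\<forall>\<epsilon>>0. (\<lambda>n. measure M {\<omega> \<in> space M. \<bar>Y n \<omega> - Z \<omega>\<bar> > \<epsilon>}) \<longlonglongrightarrow> 0)"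

end

theory Submission
  imports Defs
begin

text \<open>
The theorem is a Glivenko-Cantelli theorem. Its probabilistic content is the convergence of
$\widehat F_n(t)$ to its mean $t$ at each single point \<open>0 < t < 1\<close>. Uniformity follows because
$\widehat F_n$ and its mean are monotone with values in $[0,1]$: if they are close on the grid
$\{k/m\}$, they are close everywhere (\<open>grid_bound_monotone\<close>).

At a fixed $t=\Phi(y)$ it is enough that the variance of $\widehat F_n(t)$ tends to 0, that is,
$$\frac1{n^2}\sum_{i,j=1}^n\mathbf{P}(X_i\le y,\,X_j\le y)\to\Phi(y)^2.$$
The left-hand side equals $\mathbf{P}(X_I\le y,X_J\le y)$, where $I$ and $J$ are independent, uniform on
$\{1,\dots,n\}$ and independent of the process. Thus the claim is that $X_I$ and $X_J$ become
independent in the limit, and this can be read off from the joint characteristic function. The pair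
$(X_i,X_j)$ has characteristic function $\exp(-(a^2+b^2+2ab\,\mathrm{Cov}(X_i,X_j))/2)$, which differs
from the product of the marginal ones by at most $|ab|\,|\mathrm{Cov}(X_i,X_j)|$
(\<open>joint_char_close_to_product\<close>). Averaging over all pairs, the error is at most
$|ab|(n+\Delta(n))/n^2\to0$ (\<open>asymptotic_pairwise_independence\<close>).

The passage from characteristic functions to probabilities of quadrants is a bivariate continuity
theorem. As the limit is a product, it follows from two applications of the univariate theorem of
Levy, each under measures tilted by a bounded function of the other variable
(\<open>joint_levy_continuity\<close>).
\<close>

section \<open>Continuity theorem for asymptotically independent pairs\<close>

text \<open>Divided by its mean, a positive weight becomes the density of a new probability measure. The
hypothesis then says that the characteristic functions of $V_n$ under the new measures converge to
that of $\mu$, so the ordinary continuity theorem gives convergence of the distribution functions.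
The lower bound on the weights keeps the normalizing means away from 0.\<close>
lemma tilted_levy_continuity:
  fixes N :: "nat \<Rightarrow> 'b measure" and W V :: "nat \<Rightarrow> 'b \<Rightarrow> real"
  assumes N: "\<And>n. prob_space (N n)" and \<mu>: "real_distribution \<mu>"
    and W [measurable]: "\<And>n. W n \<in> borel_measurable (N n)"
    and V [measurable]: "\<And>n. V n \<in> borel_measurable (N n)"
    and W_bounds: "\<And>n x. 1 \<le> W n x" "\<And>n x. W n x \<le> C"
    and conv: "\<And>b. (\<lambda>n. \<integral>x. W n x *\<^sub>R iexp (b * V n x) \<partial>N n) \<longlonglongrightarrow> w *\<^sub>R char \<mu> b"
    and y: "isCont (cdf \<mu>) y"
  shows "(\<lambda>n. \<integral>x. W n x * indicator {..y} (V n x) \<partial>N n) \<longlonglongrightarrow> w * cdf \<mu> y"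
proof -
  interpret N: prob_space "N n" for n by (rule N)
  interpret \<mu>: real_distribution \<mu> by (rule \<mu>)
  define p where "p n = (\<integral>x. W n x \<partial>N n)" for n
  have W_abs: "\<bar>W n x\<bar> \<le> C" for n x using W_bounds[of n x] by simp
  have W_int: "integrable (N n) (W n)" for n
    by (rule N.integrable_const_bound[where B=C]) (use W_abs in auto)
  have p1: "1 \<le> p n" for n
  proof -
    have "(\<integral>x. 1 \<partial>N n) \<le> p n"
      unfolding p_def by (rule integral_mono) (use W_int W_bounds in auto)
    then show ?thesis by (simp add: N.prob_space)
  qed
  have p_pos: "0 < p n" for n using p1[of n] by simp
  have p_lim: "p \<longlonglongrightarrow> w"
  proof -
    have "(\<lambda>n. complex_of_real (p n)) \<longlonglongrightarrow> complex_of_real w"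
      using conv[of 0] by (simp add: \<mu>.char_zero scaleR_conv_of_real p_def)
    then show ?thesis by (simp add: tendsto_of_real_iff)
  qed
  have w1: "1 \<le> w" by (rule LIMSEQ_le_const[OF p_lim]) (use p1 in auto)
  define Q where "Q n = density (N n) (\<lambda>x. ennreal (W n x / p n))" for n
  have dens_nn: "0 \<le> W n x / p n" for n x
    using W_bounds(1)[of n x] p_pos[of n] by simp
  have Q_prob: "prob_space (Q n)" for n
  proof
    have "emeasure (Q n) (space (Q n)) = (\<integral>\<^sup>+x. ennreal (W n x / p n) \<partial>N n)"
      by (simp add: Q_def emeasure_density cong: nn_integral_cong_simp)
    also have "\<dots> = ennreal (\<integral>x. W n x / p n \<partial>N n)"
      by (rule nn_integral_eq_integral) (use W_int dens_nn in auto)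
    also have "\<dots> = 1" using p_pos[of n] by (simp add: p_def[symmetric])
    finally show "emeasure (Q n) (space (Q n)) = 1" .
  qed
  have V_Q [measurable]: "V n \<in> borel_measurable (Q n)" for n
    by (simp add: Q_def)
  define D where "D n = distr (Q n) borel (V n)" for n
  have D: "real_distribution (D n)" for n
    unfolding D_def by (rule prob_space.real_distribution_distr[OF Q_prob V_Q])
  have "(\<lambda>n. char (D n) b) \<longlonglongrightarrow> char \<mu> b" for b
  proof -
    have eq: "char (D n) b = (1 / p n) *\<^sub>R (\<integral>x. W n x *\<^sub>R iexp (b * V n x) \<partial>N n)" for n
    proof -
      have "char (D n) b = (\<integral>x. iexp (b * V n x) \<partial>Q n)"
        unfolding char_def D_def by (rule integral_distr) measurable
      also have "\<dots> = (\<integral>x. (W n x / p n) *\<^sub>R iexp (b * V n x) \<partial>N n)"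
        unfolding Q_def by (rule integral_density) (use dens_nn in auto)
      also have "\<dots> = (\<integral>x. (1 / p n) *\<^sub>R (W n x *\<^sub>R iexp (b * V n x)) \<partial>N n)"
        by (simp add: field_simps)
      also have "\<dots> = (1 / p n) *\<^sub>R (\<integral>x. W n x *\<^sub>R iexp (b * V n x) \<partial>N n)"
        by (rule integral_scaleR_right)
      finally show ?thesis .
    qed
    have "(\<lambda>n. (1 / p n) *\<^sub>R (\<integral>x. W n x *\<^sub>R iexp (b * V n x) \<partial>N n))
        \<longlonglongrightarrow> (1 / w) *\<^sub>R (w *\<^sub>R char \<mu> b)"
      by (intro tendsto_intros p_lim conv) (use w1 in auto)
    then show ?thesis using w1 by (simp add: eq)
  qed
  then have "weak_conv_m D \<mu>" by (intro levy_continuity D \<mu>)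
  then have cdf_lim: "(\<lambda>n. cdf (D n) y) \<longlonglongrightarrow> cdf \<mu> y"
    using y by (simp add: weak_conv_m_def weak_conv_def)
  have cdf_eq: "p n * cdf (D n) y = (\<integral>x. W n x * indicator {..y} (V n x) \<partial>N n)" for n
  proof -
    interpret D: real_distribution "D n" by (rule D)
    have "cdf (D n) y = (\<integral>x. indicator {..y} x \<partial>D n)"
      by (simp add: cdf_def)
    also have "\<dots> = (\<integral>x. indicator {..y} (V n x) \<partial>Q n)"
      unfolding D_def by (rule integral_distr) measurable
    also have "\<dots> = (\<integral>x. (W n x / p n) *\<^sub>R indicator {..y} (V n x) \<partial>N n)"
      unfolding Q_def by (rule integral_density) (use dens_nn in auto)
    also have "\<dots> = (\<integral>x. (1 / p n) * (W n x * indicator {..y} (V n x)) \<partial>N n)"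
      by (simp add: field_simps)
    also have "\<dots> = (1 / p n) * (\<integral>x. W n x * indicator {..y} (V n x) \<partial>N n)"
      by (rule integral_mult_right_zero)
    finally show ?thesis using p_pos[of n] by simp
  qed
  show ?thesis using tendsto_mult[OF p_lim cdf_lim] by (simp add: cdf_eq)
qed

text \<open>Both \<open>2 + W\<close> and the constant 1 are admissible densities for the preceding lemma, and \<open>W\<close> is a linear
combination of them.\<close>
lemma weighted_levy_continuity:
  fixes N :: "nat \<Rightarrow> 'b measure" and W V :: "nat \<Rightarrow> 'b \<Rightarrow> real"
  assumes N: "\<And>n. prob_space (N n)" and \<mu>: "real_distribution \<mu>"
    and W [measurable]: "\<And>n. W n \<in> borel_measurable (N n)"
    and V [measurable]: "\<And>n. V n \<in> borel_measurable (N n)"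
    and W_bound: "\<And>n x. \<bar>W n x\<bar> \<le> 1"
    and conv: "\<And>b. (\<lambda>n. \<integral>x. iexp (b * V n x) \<partial>N n) \<longlonglongrightarrow> char \<mu> b"
    and convW: "\<And>b. (\<lambda>n. \<integral>x. W n x *\<^sub>R iexp (b * V n x) \<partial>N n) \<longlonglongrightarrow> w *\<^sub>R char \<mu> b"
    and y: "isCont (cdf \<mu>) y"
  shows "(\<lambda>n. \<integral>x. W n x * indicator {..y} (V n x) \<partial>N n) \<longlonglongrightarrow> w * cdf \<mu> y"
proof -
  interpret N: prob_space "N n" for n by (rule N)
  have iexp_int: "integrable (N n) (\<lambda>x. iexp (b * V n x))" for n b
    by (rule N.integrable_iexp) auto
  have W_iexp_int: "integrable (N n) (\<lambda>x. W n x *\<^sub>R iexp (b * V n x))" for n b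
    by (rule N.integrable_const_bound[where B=1]) (use W_bound in auto)
  have [simp]: "integrable (N n) (\<lambda>x. indicator {..y} (V n x) :: real)" for n
    by (rule N.integrable_const_bound[where B=1]) (auto split: split_indicator)
  have [simp]: "integrable (N n) (\<lambda>x. W n x * indicator {..y} (V n x))" for n
    by (rule N.integrable_const_bound[where B=1]) (use W_bound in \<open>auto split: split_indicator\<close>)
  have W2: "1 \<le> 2 + W n x" "2 + W n x \<le> 3" for n x using W_bound[of n x] by auto
  have "(\<lambda>n. \<integral>x. (2 + W n x) * indicator {..y} (V n x) \<partial>N n) \<longlonglongrightarrow> (2 + w) * cdf \<mu> y"
  proof (rule tilted_levy_continuity[OF N \<mu> _ V W2 _ y])
    fix b
    have "(\<lambda>n. 2 *\<^sub>R (\<integral>x. iexp (b * V n x) \<partial>N n) + (\<integral>x. W n x *\<^sub>R iexp (b * V n x) \<partial>N n))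
        \<longlonglongrightarrow> 2 *\<^sub>R char \<mu> b + w *\<^sub>R char \<mu> b"
      by (intro tendsto_intros conv convW)
    moreover have "2 *\<^sub>R (\<integral>x. iexp (b * V n x) \<partial>N n) + (\<integral>x. W n x *\<^sub>R iexp (b * V n x) \<partial>N n)
        = (\<integral>x. (2 + W n x) *\<^sub>R iexp (b * V n x) \<partial>N n)" for n
      unfolding scaleR_add_left using iexp_int W_iexp_int
      by (subst Bochner_Integration.integral_add) (intro integrable_scaleR_right; assumption | simp)+
    ultimately show "(\<lambda>n. \<integral>x. (2 + W n x) *\<^sub>R iexp (b * V n x) \<partial>N n)
        \<longlonglongrightarrow> (2 + w) *\<^sub>R char \<mu> b"
      by (simp add: scaleR_add_left)
  qed simp
  moreover have "(\<lambda>n. \<integral>x. 1 * indicator {..y} (V n x) \<partial>N n) \<longlonglongrightarrow> 1 * cdf \<mu> y"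
    by (rule tilted_levy_continuity[OF N \<mu> _ V _ _ _ y, where C=1]) (use conv in auto)
  ultimately have "(\<lambda>n. (\<integral>x. (2 + W n x) * indicator {..y} (V n x) \<partial>N n)
      - 2 * (\<integral>x. 1 * indicator {..y} (V n x) \<partial>N n)) \<longlonglongrightarrow> (2 + w) * cdf \<mu> y - 2 * (1 * cdf \<mu> y)"
    by (intro tendsto_intros)
  moreover have "(\<integral>x. (2 + W n x) * indicator {..y} (V n x) \<partial>N n)
      - 2 * (\<integral>x. 1 * indicator {..y} (V n x) \<partial>N n)
      = (\<integral>x. W n x * indicator {..y} (V n x) \<partial>N n)" for n
    by (simp only: distrib_right) (subst Bochner_Integration.integral_add; simp)
  ultimately show ?thesis by (simp add: algebra_simps)
qed

text \<open>A two-dimensional continuity theorem with a product limit, obtained from the one-dimensional theorem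
applied in one variable at a time. The weights $\cos(aU_n)$ and $\sin(aU_n)$ turn the hypothesis into
statements about $V_n$ alone, which yields the limit of
$\mathbf{E}\,e^{iaU_n}\mathbf{1}(V_n\le y)$. This in turn is the hypothesis about $U_n$ for the weight
$\mathbf{1}(V_n\le y)$.\<close>
lemma joint_levy_continuity:
  fixes N :: "nat \<Rightarrow> 'b measure" and U V :: "nat \<Rightarrow> 'b \<Rightarrow> real"
  assumes N: "\<And>n. prob_space (N n)" and \<mu>: "real_distribution \<mu>" and \<nu>: "real_distribution \<nu>"
    and U [measurable]: "\<And>n. U n \<in> borel_measurable (N n)"
    and V [measurable]: "\<And>n. V n \<in> borel_measurable (N n)"
    and conv: "\<And>a b. (\<lambda>n. \<integral>\<omega>. iexp (a * U n \<omega> + b * V n \<omega>) \<partial>N n) \<longlonglongrightarrow> char \<mu> a * char \<nu> b"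
    and x: "isCont (cdf \<mu>) x" and y: "isCont (cdf \<nu>) y"
  shows "(\<lambda>n. \<integral>\<omega>. indicator {..x} (U n \<omega>) * indicator {..y} (V n \<omega>) \<partial>N n)
    \<longlonglongrightarrow> cdf \<mu> x * cdf \<nu> y"
proof -
  interpret N: prob_space "N n" for n by (rule N)
  interpret \<mu>: real_distribution \<mu> by (rule \<mu>)
  interpret \<nu>: real_distribution \<nu> by (rule \<nu>)
  have iexp_int: "integrable (N n) (\<lambda>\<omega>. iexp (a * U n \<omega> + b * V n \<omega>))" for n a b
    by (rule N.integrable_iexp) auto
  have convU: "(\<lambda>n. \<integral>\<omega>. iexp (a * U n \<omega>) \<partial>N n) \<longlonglongrightarrow> char \<mu> a" for a
    using conv[of a 0] by (simp add: \<nu>.char_zero)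
  have convV: "(\<lambda>n. \<integral>\<omega>. iexp (b * V n \<omega>) \<partial>N n) \<longlonglongrightarrow> char \<nu> b" for b
    using conv[of 0 b] by (simp add: \<mu>.char_zero)
  have char_uminus: "char \<mu> (-a) = cnj (char \<mu> a)" for a
    unfolding char_def Bochner_Integration.integral_cnj[symmetric] by (simp add: exp_cnj)
  have cos_conv: "(\<lambda>n. \<integral>\<omega>. cos (a * U n \<omega>) * indicator {..y} (V n \<omega>) \<partial>N n)
      \<longlonglongrightarrow> Re (char \<mu> a) * cdf \<nu> y" for a
  proof (rule weighted_levy_continuity[OF N \<nu> _ V _ convV _ y])
    fix b
    have eq: "(\<integral>\<omega>. cos (a * U n \<omega>) *\<^sub>R iexp (b * V n \<omega>) \<partial>N n)
       = ((\<integral>\<omega>. iexp (a * U n \<omega> + b * V n \<omega>) \<partial>N n)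
        + (\<integral>\<omega>. iexp ((-a) * U n \<omega> + b * V n \<omega>) \<partial>N n)) / 2" for n
    proof -
      have "cos (a * u) *\<^sub>R iexp (b * v) = (iexp (a * u + b * v) + iexp ((-a) * u + b * v)) / 2"
        for u v :: real
        by (simp add: complex_eq_iff Re_exp Im_exp cos_add sin_add cos_diff sin_diff algebra_simps)
      then have "(\<integral>\<omega>. cos (a * U n \<omega>) *\<^sub>R iexp (b * V n \<omega>) \<partial>N n)
        = (\<integral>\<omega>. (iexp (a * U n \<omega> + b * V n \<omega>) + iexp ((-a) * U n \<omega> + b * V n \<omega>)) / 2 \<partial>N n)"
        by (simp only:)
      also have "\<dots> = (\<integral>\<omega>. iexp (a * U n \<omega> + b * V n \<omega>) + iexp ((-a) * U n \<omega> + b * V n \<omega>) \<partial>N n) / 2"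
        by (rule integral_divide_zero)
      also have "\<dots> = ((\<integral>\<omega>. iexp (a * U n \<omega> + b * V n \<omega>) \<partial>N n)
        + (\<integral>\<omega>. iexp ((-a) * U n \<omega> + b * V n \<omega>) \<partial>N n)) / 2"
        by (subst Bochner_Integration.integral_add) (rule iexp_int refl)+
      finally show ?thesis .
    qed
    have "(\<lambda>n. ((\<integral>\<omega>. iexp (a * U n \<omega> + b * V n \<omega>) \<partial>N n)
        + (\<integral>\<omega>. iexp ((-a) * U n \<omega> + b * V n \<omega>) \<partial>N n)) / 2)
      \<longlonglongrightarrow> (char \<mu> a * char \<nu> b + char \<mu> (-a) * char \<nu> b) / 2"
      by (intro tendsto_intros conv) simp
    also have "(char \<mu> a * char \<nu> b + char \<mu> (-a) * char \<nu> b) / 2 = Re (char \<mu> a) *\<^sub>R char \<nu> b"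
      by (simp add: char_uminus complex_eq_iff algebra_simps)
    finally show "(\<lambda>n. \<integral>\<omega>. cos (a * U n \<omega>) *\<^sub>R iexp (b * V n \<omega>) \<partial>N n)
        \<longlonglongrightarrow> Re (char \<mu> a) *\<^sub>R char \<nu> b"
      unfolding eq .
  qed auto
  have sin_conv: "(\<lambda>n. \<integral>\<omega>. sin (a * U n \<omega>) * indicator {..y} (V n \<omega>) \<partial>N n)
      \<longlonglongrightarrow> Im (char \<mu> a) * cdf \<nu> y" for a
  proof (rule weighted_levy_continuity[OF N \<nu> _ V _ convV _ y])
    fix b
    have eq: "(\<integral>\<omega>. sin (a * U n \<omega>) *\<^sub>R iexp (b * V n \<omega>) \<partial>N n)
       = ((\<integral>\<omega>. iexp (a * U n \<omega> + b * V n \<omega>) \<partial>N n)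
        - (\<integral>\<omega>. iexp ((-a) * U n \<omega> + b * V n \<omega>) \<partial>N n)) / (2 * \<i>)" for n
    proof -
      have "sin (a * u) *\<^sub>R iexp (b * v) = (iexp (a * u + b * v) - iexp ((-a) * u + b * v)) / (2 * \<i>)"
        for u v :: real
        by (simp add: complex_eq_iff Re_exp Im_exp cos_add sin_add cos_diff sin_diff algebra_simps Re_divide Im_divide)
      then have "(\<integral>\<omega>. sin (a * U n \<omega>) *\<^sub>R iexp (b * V n \<omega>) \<partial>N n)
        = (\<integral>\<omega>. (iexp (a * U n \<omega> + b * V n \<omega>) - iexp ((-a) * U n \<omega> + b * V n \<omega>)) / (2 * \<i>) \<partial>N n)"
        by (simp only:)
      also have "\<dots> = (\<integral>\<omega>. iexp (a * U n \<omega> + b * V n \<omega>) - iexp ((-a) * U n \<omega> + b * V n \<omega>) \<partial>N n) / (2 * \<i>)"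
        by (rule integral_divide_zero)
      also have "\<dots> = ((\<integral>\<omega>. iexp (a * U n \<omega> + b * V n \<omega>) \<partial>N n)
        - (\<integral>\<omega>. iexp ((-a) * U n \<omega> + b * V n \<omega>) \<partial>N n)) / (2 * \<i>)"
        by (subst Bochner_Integration.integral_diff) (rule iexp_int refl)+
      finally show ?thesis .
    qed
    have "(\<lambda>n. ((\<integral>\<omega>. iexp (a * U n \<omega> + b * V n \<omega>) \<partial>N n)
        - (\<integral>\<omega>. iexp ((-a) * U n \<omega> + b * V n \<omega>) \<partial>N n)) / (2 * \<i>))
      \<longlonglongrightarrow> (char \<mu> a * char \<nu> b - char \<mu> (-a) * char \<nu> b) / (2 * \<i>)"
      by (intro tendsto_intros conv) simp
    also have "(char \<mu> a * char \<nu> b - char \<mu> (-a) * char \<nu> b) / (2 * \<i>) = Im (char \<mu> a) *\<^sub>R char \<nu> b"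
      by (simp add: char_uminus complex_eq_iff algebra_simps Re_divide Im_divide)
    finally show "(\<lambda>n. \<integral>\<omega>. sin (a * U n \<omega>) *\<^sub>R iexp (b * V n \<omega>) \<partial>N n)
        \<longlonglongrightarrow> Im (char \<mu> a) *\<^sub>R char \<nu> b"
      unfolding eq .
  qed auto
  have "(\<lambda>n. \<integral>\<omega>. indicator {..y} (V n \<omega>) * indicator {..x} (U n \<omega>) \<partial>N n) \<longlonglongrightarrow> cdf \<nu> y * cdf \<mu> x"
  proof (rule weighted_levy_continuity[OF N \<mu> _ U _ convU _ x])
    fix a
    have eq: "(\<integral>\<omega>. indicator {..y} (V n \<omega>) *\<^sub>R iexp (a * U n \<omega>) \<partial>N n)
      = Complex (\<integral>\<omega>. cos (a * U n \<omega>) * indicator {..y} (V n \<omega>) \<partial>N n)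
          (\<integral>\<omega>. sin (a * U n \<omega>) * indicator {..y} (V n \<omega>) \<partial>N n)" for n
    proof -
      have int: "integrable (N n) (\<lambda>\<omega>. indicator {..y} (V n \<omega>) *\<^sub>R iexp (a * U n \<omega>))"
        by (rule N.integrable_const_bound[where B=1]) (auto split: split_indicator)
      show ?thesis
        unfolding complex_eq_iff integral_Re[OF int, symmetric] integral_Im[OF int, symmetric]
        by (simp add: Re_exp Im_exp mult.commute)
    qed
    have "(\<lambda>n. \<integral>\<omega>. indicator {..y} (V n \<omega>) *\<^sub>R iexp (a * U n \<omega>) \<partial>N n)
      \<longlonglongrightarrow> Complex (Re (char \<mu> a) * cdf \<nu> y) (Im (char \<mu> a) * cdf \<nu> y)"
      unfolding eq by (intro tendsto_Complex cos_conv sin_conv)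
    also have "Complex (Re (char \<mu> a) * cdf \<nu> y) (Im (char \<mu> a) * cdf \<nu> y) = cdf \<nu> y *\<^sub>R char \<mu> a"
      by (simp add: complex_eq_iff)
    finally show "(\<lambda>n. \<integral>\<omega>. indicator {..y} (V n \<omega>) *\<^sub>R iexp (a * U n \<omega>) \<partial>N n)
      \<longlonglongrightarrow> cdf \<nu> y *\<^sub>R char \<mu> a" .
  qed (auto split: split_indicator)
  then show ?thesis by (simp add: mult.commute)
qed

section \<open>Characteristic functions of pairs in a Gaussian process\<close>

lemma expectation_iexp_centered_gaussian:
  assumes M: "prob_space M" and Y [measurable]: "Y \<in> borel_measurable M"
    and law: "gaussian_law (distr M borel Y)" and centered: "(\<integral>\<omega>. Y \<omega> \<partial>M) = 0"
  shows "(\<integral>\<omega>. iexp (Y \<omega>) \<partial>M) = complex_of_real (exp (- (\<integral>\<omega>. (Y \<omega>)\<^sup>2 \<partial>M) / 2))"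
proof -
  interpret prob_space M by (rule M)
  from law consider m where "distr M borel Y = return borel m"
    | m s where "s > 0" "distr M borel Y = density lborel (normal_density m s)"
    unfolding gaussian_law_def by auto
  then show ?thesis
  proof cases
    case 1
    have at_m: "(\<integral>\<omega>. f (Y \<omega>) \<partial>M) = f m" if [measurable]: "f \<in> borel_measurable borel"
      for f :: "real \<Rightarrow> 'b::{banach, second_countable_topology}"
    proof -
      have "(\<integral>\<omega>. f (Y \<omega>) \<partial>M) = (\<integral>x. f x \<partial>distr M borel Y)"
        by (rule integral_distr[symmetric]) measurable
      also have "\<dots> = f m" unfolding 1 by (rule integral_return) (use that in auto)
      finally show ?thesis .
    qed
    have "m = 0" using centered at_m[of "\<lambda>x. x"] by simp
    then show ?thesis using at_m[of "\<lambda>x. iexp x"] at_m[of "\<lambda>x. x\<^sup>2"] by simp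
  next
    case 2
    have D: "distributed M lborel Y (normal_density m s)"
      unfolding distributed_def using 2 distr_cong[of M M lborel borel Y Y] by auto
    have m: "m = 0" using normal_distributed_expectation[OF \<open>s > 0\<close> D] centered by simp
    have s2: "(\<integral>\<omega>. (Y \<omega>)\<^sup>2 \<partial>M) = s\<^sup>2"
      using normal_distributed_variance[OF \<open>s > 0\<close> D] centered by simp
    have "distributed M lborel (\<lambda>\<omega>. (Y \<omega> - m) / s) std_normal_density"
      using normal_standard_normal_convert[OF \<open>s > 0\<close>, of Y m] D Y by simp
    then have "distr M borel (\<lambda>\<omega>. Y \<omega> / s) = std_normal_distribution"
      unfolding distributed_def m using distr_cong[of M M borel lborel "\<lambda>\<omega>. Y \<omega> / s"] by auto
    then have "char (distr M borel (\<lambda>\<omega>. Y \<omega> / s)) s = exp (- (s\<^sup>2) / 2)"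
      by (simp add: char_std_normal_distribution)
    moreover have "char (distr M borel (\<lambda>\<omega>. Y \<omega> / s)) s = (\<integral>\<omega>. iexp (s * (Y \<omega> / s)) \<partial>M)"
      unfolding char_def by (rule integral_distr) measurable
    ultimately show ?thesis using \<open>s > 0\<close> s2 by simp
  qed
qed

lemma standardized_gaussian_process_measurable:
  "standardized_gaussian_process M X \<Longrightarrow> 1 \<le> k \<Longrightarrow> X k \<in> borel_measurable M"
  by (simp add: standardized_gaussian_process_def gaussian_process_def)

lemma standardized_gaussian_process_moments:
  assumes X: "standardized_gaussian_process M X" and k: "1 \<le> k"
  shows "(\<integral>\<omega>. X k \<omega> \<partial>M) = 0" "integrable M (\<lambda>\<omega>. (X k \<omega>)\<^sup>2)" "(\<integral>\<omega>. (X k \<omega>)\<^sup>2 \<partial>M) = 1"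
    "integrable M (X k)"
proof -
  have [measurable]: "X k \<in> borel_measurable M"
    by (rule standardized_gaussian_process_measurable[OF X k])
  have law: "distr M borel (X k) = std_normal_distribution"
    using X k by (simp add: standardized_gaussian_process_def)
  have int: "(\<integral>\<omega>. (X k \<omega>) ^ p \<partial>M) = (\<integral>x. x ^ p \<partial>std_normal_distribution)" for p
    unfolding law[symmetric] by (rule integral_distr[symmetric]) measurable
  have intable: "integrable M (\<lambda>\<omega>. (X k \<omega>) ^ p)" for p
  proof -
    have "integrable (distr M borel (X k)) (\<lambda>x. x ^ p)"
      unfolding law by (rule integrable_std_normal_distribution_moment)
    then show ?thesis by (subst (asm) integrable_distr_eq) measurable
  qed
  show "(\<integral>\<omega>. X k \<omega> \<partial>M) = 0"
    using int[of 1] integral_std_normal_distribution_moment_odd[of 1] by simp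
  show "(\<integral>\<omega>. (X k \<omega>)\<^sup>2 \<partial>M) = 1"
    using int[of 2] std_normal_distribution_even_moments(1)[of 1] by simp
  show "integrable M (\<lambda>\<omega>. (X k \<omega>)\<^sup>2)" by (rule intable)
  show "integrable M (X k)" using intable[of 1] by simp
qed

text \<open>The case \<open>i = j\<close> is included, so that the diagonal pairs need no separate treatment below.\<close>
lemma standardized_gaussian_process_linear_combination:
  assumes X: "standardized_gaussian_process M X" and i: "1 \<le> i" and j: "1 \<le> j"
  shows "gaussian_law (distr M borel (\<lambda>\<omega>. a * X i \<omega> + b * X j \<omega>))"
    "(\<integral>\<omega>. a * X i \<omega> + b * X j \<omega> \<partial>M) = 0"
    "(\<integral>\<omega>. (a * X i \<omega> + b * X j \<omega>)\<^sup>2 \<partial>M) = a\<^sup>2 + b\<^sup>2 + 2 * a * b * covariance M (X i) (X j)"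
proof -
  have Xm [measurable]: "X k \<in> borel_measurable M" if "1 \<le> k" for k
    by (rule standardized_gaussian_process_measurable[OF X that])
  note [measurable] = Xm[OF i] Xm[OF j]
  note mi = standardized_gaussian_process_moments[OF X i]
  note mj = standardized_gaussian_process_moments[OF X j]
  define J where "J = {i, j}"
  \<comment> \<open>For \<open>i = j\<close> the two summands of the coefficient add up.\<close>
  define c where "c k = a * of_bool (k = i) + b * of_bool (k = j)" for k
  have J: "finite J" "J \<noteq> {}" "J \<subseteq> {1..}" using i j by (auto simp: J_def)
  have "multivariate_gaussian_law J (distr M (Pi\<^sub>M J (\<lambda>_. borel)) (\<lambda>\<omega>. \<lambda>k\<in>J. X k \<omega>))"
    using X J by (simp add: standardized_gaussian_process_def gaussian_process_def)
  then have "gaussian_law (distr (distr M (Pi\<^sub>M J (\<lambda>_. borel)) (\<lambda>\<omega>. \<lambda>k\<in>J. X k \<omega>)) borel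
      (\<lambda>x. \<Sum>k\<in>J. c k * x k))"
    unfolding multivariate_gaussian_law_def by blast
  also have "distr (distr M (Pi\<^sub>M J (\<lambda>_. borel)) (\<lambda>\<omega>. \<lambda>k\<in>J. X k \<omega>)) borel
      (\<lambda>x. \<Sum>k\<in>J. c k * x k) = distr M borel ((\<lambda>x. \<Sum>k\<in>J. c k * x k) \<circ> (\<lambda>\<omega>. \<lambda>k\<in>J. X k \<omega>))"
  proof (rule distr_distr)
    show "(\<lambda>\<omega>. \<lambda>k\<in>J. X k \<omega>) \<in> measurable M (Pi\<^sub>M J (\<lambda>_. borel))"
      by (rule measurable_restrict) (use Xm J in auto)
  qed measurable
  also have "(\<lambda>x. \<Sum>k\<in>J. c k * x k) \<circ> (\<lambda>\<omega>. \<lambda>k\<in>J. X k \<omega>) = (\<lambda>\<omega>. a * X i \<omega> + b * X j \<omega>)"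
    by (cases "i = j") (auto simp: fun_eq_iff J_def c_def algebra_simps)
  finally show "gaussian_law (distr M borel (\<lambda>\<omega>. a * X i \<omega> + b * X j \<omega>))" .
  have prod_int: "integrable M (\<lambda>\<omega>. X i \<omega> * X j \<omega>)"
  proof (rule Bochner_Integration.integrable_bound)
    show "integrable M (\<lambda>\<omega>. (X i \<omega>)\<^sup>2 + (X j \<omega>)\<^sup>2)" using mi mj by simp
    have "\<bar>x * y\<bar> \<le> x\<^sup>2 + y\<^sup>2" for x y :: real
      using zero_le_power2[of "x - y"] zero_le_power2[of "x + y"] zero_le_power2[of x] zero_le_power2[of y]
      unfolding power2_diff power2_sum abs_le_iff by linarith
    then show "AE \<omega> in M. norm (X i \<omega> * X j \<omega>) \<le> norm ((X i \<omega>)\<^sup>2 + (X j \<omega>)\<^sup>2)"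
      by simp
  qed measurable
  have cov: "covariance M (X i) (X j) = (\<integral>\<omega>. X i \<omega> * X j \<omega> \<partial>M)"
    unfolding covariance_def using mi mj by simp
  show "(\<integral>\<omega>. a * X i \<omega> + b * X j \<omega> \<partial>M) = 0" using mi mj by simp
  have "(\<integral>\<omega>. (a * X i \<omega> + b * X j \<omega>)\<^sup>2 \<partial>M)
    = (\<integral>\<omega>. a\<^sup>2 * (X i \<omega>)\<^sup>2 + b\<^sup>2 * (X j \<omega>)\<^sup>2 + (2 * a * b) * (X i \<omega> * X j \<omega>) \<partial>M)"
    by (simp add: power2_eq_square algebra_simps)
  also have "\<dots> = a\<^sup>2 + b\<^sup>2 + 2 * a * b * covariance M (X i) (X j)"
    using mi mj prod_int cov by simp
  finally show "(\<integral>\<omega>. (a * X i \<omega> + b * X j \<omega>)\<^sup>2 \<partial>M) = a\<^sup>2 + b\<^sup>2 + 2 * a * b * covariance M (X i) (X j)" .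
qed


lemma abs_exp_neg_diff_le:
  fixes u v :: real
  assumes "0 \<le> u" "0 \<le> v"
  shows "\<bar>exp (-u) - exp (-v)\<bar> \<le> \<bar>u - v\<bar>"
proof -
  have *: "\<bar>exp (-u) - exp (-v)\<bar> \<le> v - u" if "0 \<le> u" "u \<le> v" for u v :: real
  proof -
    have "exp (-u) - exp (-v) = exp (-u) * (1 - exp (-(v - u)))"
      by (simp add: exp_diff field_simps flip: exp_add)
    also have "\<dots> \<le> 1 * (v - u)"
    proof (rule mult_mono)
      show "1 - exp (-(v - u)) \<le> v - u"
        using exp_ge_add_one_self[of "-(v - u)"] by linarith
    qed (use that in auto)
    finally show ?thesis using that by simp
  qed
  show ?thesis using *[of u v] *[of v u] assms by (cases "u \<le> v") auto
qed

text \<open>The left-hand side is the difference of $e^{-v/2}$ and $e^{-(a^2+b^2)/2}$, where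
$v=a^2+b^2+2ab\,\mathrm{Cov}(X_i,X_j)$ is the variance of $aX_i+bX_j$. Both exponents are
nonpositive, and the exponential function is 1-Lipschitz there.\<close>
lemma joint_char_close_to_product:
  assumes M: "prob_space M" and X: "standardized_gaussian_process M X" and i: "1 \<le> i" and j: "1 \<le> j"
  shows "cmod ((\<integral>\<omega>. iexp (a * X i \<omega> + b * X j \<omega>) \<partial>M)
      - char std_normal_distribution a * char std_normal_distribution b)
    \<le> \<bar>a * b\<bar> * \<bar>covariance M (X i) (X j)\<bar>"
proof -
  note [measurable] = standardized_gaussian_process_measurable[OF X i]
    standardized_gaussian_process_measurable[OF X j]
  note lc = standardized_gaussian_process_linear_combination[OF X i j, of a b]
  define v where "v = (\<integral>\<omega>. (a * X i \<omega> + b * X j \<omega>)\<^sup>2 \<partial>M)"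
  have v: "v = a\<^sup>2 + b\<^sup>2 + 2 * a * b * covariance M (X i) (X j)" unfolding v_def by (rule lc)
  have "0 \<le> v" unfolding v_def by simp
  have "(\<integral>\<omega>. iexp (a * X i \<omega> + b * X j \<omega>) \<partial>M) = complex_of_real (exp (- v / 2))"
    unfolding v_def by (rule expectation_iexp_centered_gaussian[OF M _ lc(1,2)]) measurable
  moreover have "char std_normal_distribution a * char std_normal_distribution b
      = complex_of_real (exp (- ((a\<^sup>2 + b\<^sup>2) / 2)))"
    by (simp add: char_std_normal_distribution add_divide_distrib exp_add[symmetric] exp_of_real[symmetric] flip: of_real_mult)
  ultimately have "cmod ((\<integral>\<omega>. iexp (a * X i \<omega> + b * X j \<omega>) \<partial>M)
      - char std_normal_distribution a * char std_normal_distribution b)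
    = \<bar>exp (- (v / 2)) - exp (- ((a\<^sup>2 + b\<^sup>2) / 2))\<bar>"
    by (simp del: of_real_diff flip: of_real_diff)
  also have "\<dots> \<le> \<bar>v / 2 - (a\<^sup>2 + b\<^sup>2) / 2\<bar>"
    by (rule abs_exp_neg_diff_le) (use \<open>0 \<le> v\<close> in auto)
  also have "v / 2 - (a\<^sup>2 + b\<^sup>2) / 2 = (a * b) * covariance M (X i) (X j)"
    by (simp add: v field_simps)
  finally show ?thesis by (simp add: abs_mult)
qed

section \<open>Asymptotic independence of two random members of the sample\<close>

text \<open>The off-diagonal pairs are counted twice by symmetry, and every diagonal covariance is 1.\<close>
lemma sum_abs_covariance_eq:
  assumes X: "standardized_gaussian_process M X"
  shows "(\<Sum>(i, j)\<in>{1..n} \<times> {1..n}. \<bar>covariance M (X i) (X j)\<bar>) = real n + dependence_measure M X n"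
proof -
  let ?c = "\<lambda>(i, j). \<bar>covariance M (X i) (X j)\<bar>"
  define L where "L = {(i, j). 1 \<le> i \<and> i < j \<and> j \<le> n}"
  define D where "D = (\<lambda>i. (i, i)) ` {1..n}"
  have fin: "finite L" by (rule finite_subset[of _ "{1..n} \<times> {1..n}"]) (auto simp: L_def)
  have split: "{1..n} \<times> {1..n} = D \<union> (L \<union> prod.swap ` L)"
    by (auto simp: L_def D_def image_iff)
  have diag: "covariance M (X i) (X i) = 1" if "1 \<le> i" for i
    using standardized_gaussian_process_moments[OF X that]
    by (simp add: covariance_def power2_eq_square)
  have "sum ?c ({1..n} \<times> {1..n}) = sum ?c D + (sum ?c L + sum ?c (prod.swap ` L))"
    unfolding split using fin
    by (subst sum.union_disjoint; (subst sum.union_disjoint)?) (auto simp: L_def D_def)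
  also have "sum ?c D = real n"
    unfolding D_def by (subst sum.reindex) (auto simp: inj_on_def diag)
  also have "sum ?c (prod.swap ` L) = sum ?c L"
    by (subst sum.reindex) (auto simp: covariance_def mult.commute intro!: sum.cong)
  finally show ?thesis by (simp add: dependence_measure_def L_def)
qed

text \<open>Drawing an index uniformly and independently of the process turns averages over the index set into
expectations.\<close>
lemma integral_uniform_random_index:
  fixes f :: "'i \<times> 'a \<Rightarrow> 'b::{banach, second_countable_topology}"
  assumes M: "prob_space M" and A: "finite A" "A \<noteq> {}"
    and f: "\<And>k. k \<in> A \<Longrightarrow> (\<lambda>\<omega>. f (k, \<omega>)) \<in> borel_measurable M" and bound: "\<And>z. norm (f z) \<le> B"
  shows "(\<integral>z. f z \<partial>(uniform_count_measure A \<Otimes>\<^sub>M M)) = (\<Sum>k\<in>A. \<integral>\<omega>. f (k, \<omega>) \<partial>M) /\<^sub>R real (card A)"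
proof -
  interpret A: prob_space "uniform_count_measure A" by (rule prob_space_uniform_count_measure[OF A])
  interpret M: prob_space M by (rule M)
  interpret pair_prob_space "uniform_count_measure A" M ..
  have "f \<in> borel_measurable (count_space A \<Otimes>\<^sub>M M)"
    by (rule measurable_pair_measure_countable1) (use A f in \<open>auto intro: countable_finite\<close>)
  then have [measurable]: "f \<in> borel_measurable (uniform_count_measure A \<Otimes>\<^sub>M M)"
    by (simp cong: measurable_cong_sets sets_pair_measure_cong add: sets_uniform_count_measure_count_space)
  have int: "integrable (uniform_count_measure A \<Otimes>\<^sub>M M) f"
    by (rule integrable_const_bound[where B=B]) (use bound in auto)
  have "(\<integral>z. f z \<partial>(uniform_count_measure A \<Otimes>\<^sub>M M)) = (\<integral>k. \<integral>\<omega>. f (k, \<omega>) \<partial>M \<partial>uniform_count_measure A)"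
    by (rule integral_fst'[symmetric, OF int])
  also have "\<dots> = (\<Sum>k\<in>A. \<integral>\<omega>. f (k, \<omega>) \<partial>M) /\<^sub>R real (card A)"
    using A by (simp add: uniform_count_measure_def lebesgue_integral_point_measure_finite scaleR_sum_right inverse_eq_divide)
  finally show ?thesis .
qed

text \<open>The average is the probability that $X_I\le x$ and $X_J\le y$ for two independent uniform indices
$I,J\in\{1,\dots,n\}$. The joint characteristic function of $(X_I,X_J)$ differs from the product of
the standard normal ones by at most $|ab|(n+\Delta(n))/n^2$, so the continuity theorem for pairs
applies.\<close>
lemma asymptotic_pairwise_independence:
  assumes M: "prob_space M" and X: "standardized_gaussian_process M X"
    and dep: "(\<lambda>n. dependence_measure M X n / real n ^ 2) \<longlonglongrightarrow> 0"
    and x: "isCont (cdf std_normal_distribution) x" and y: "isCont (cdf std_normal_distribution) y"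
  shows "(\<lambda>n. (\<Sum>(i, j)\<in>{1..n} \<times> {1..n}. \<integral>\<omega>. indicator {..x} (X i \<omega>) * indicator {..y} (X j \<omega>) \<partial>M)
      / (real n)\<^sup>2) \<longlonglongrightarrow> cdf std_normal_distribution x * cdf std_normal_distribution y"
proof -
  \<comment> \<open>The sample size is \<open>Suc n\<close> because there is no uniform distribution on the empty index set.\<close>
  define P where "P n = {1..Suc n} \<times> {1..Suc n}" for n
  define N where "N n = uniform_count_measure (P n) \<Otimes>\<^sub>M M" for n
  define U where "U = (\<lambda>((i :: nat, j :: nat), \<omega>). X i \<omega>)"
  define V where "V = (\<lambda>((i :: nat, j :: nat), \<omega>). X j \<omega>)"
  have P: "finite (P n)" "P n \<noteq> {}" for n by (auto simp: P_def)
  have card_P: "real (card (P n)) = (real (Suc n))\<^sup>2" for n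
    by (simp add: P_def power2_eq_square del: of_nat_Suc mult_Suc mult_Suc_right)
  note Xm = standardized_gaussian_process_measurable[OF X]
  have N_prob: "prob_space (N n)" for n
  proof -
    interpret I: prob_space "uniform_count_measure (P n)" by (rule prob_space_uniform_count_measure[OF P])
    interpret M: prob_space M by (rule M)
    interpret pair_prob_space "uniform_count_measure (P n)" M ..
    show ?thesis unfolding N_def by (rule P.prob_space_axioms)
  qed
  have meas: "f \<in> borel_measurable (N n)"
    if "\<And>i j. 1 \<le> i \<Longrightarrow> 1 \<le> j \<Longrightarrow> (\<lambda>\<omega>. f ((i, j), \<omega>)) \<in> borel_measurable M" for f :: "_ \<Rightarrow> real" and n
  proof -
    have "f \<in> borel_measurable (count_space (P n) \<Otimes>\<^sub>M M)"
      by (rule measurable_pair_measure_countable1) (use P that in \<open>auto intro: countable_finite simp: P_def\<close>)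
    then show ?thesis
      by (simp add: N_def sets_uniform_count_measure_count_space cong: measurable_cong_sets sets_pair_measure_cong)
  qed
  have Um: "U \<in> borel_measurable (N n)" for n by (rule meas) (simp add: U_def Xm)
  have Vm: "V \<in> borel_measurable (N n)" for n by (rule meas) (simp add: V_def Xm)
  have "(\<lambda>n. \<integral>z. iexp (a * U z + b * V z) \<partial>N n)
      \<longlonglongrightarrow> char std_normal_distribution a * char std_normal_distribution b" for a b
  proof -
    \<comment> \<open>The diagonal pairs contribute the summand \<open>1 / n\<close> to the error.\<close>
    let ?g = "char std_normal_distribution a * char std_normal_distribution b"
    have bound: "cmod ((\<integral>z. iexp (a * U z + b * V z) \<partial>N n) - ?g)
        \<le> \<bar>a * b\<bar> * (1 / real (Suc n) + dependence_measure M X (Suc n) / (real (Suc n))\<^sup>2)" for n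
    proof -
      define h where "h = (\<lambda>(i, j). \<integral>\<omega>. iexp (a * X i \<omega> + b * X j \<omega>) \<partial>M)"
      define r where "r = real (Suc n)"
      have r: "0 < r" by (simp add: r_def)
      have card_r: "real (card (P n)) = r\<^sup>2" unfolding card_P r_def ..
      have "(\<integral>z. iexp (a * U z + b * V z) \<partial>N n)
        = (\<Sum>k\<in>P n. \<integral>\<omega>. iexp (a * U (k, \<omega>) + b * V (k, \<omega>)) \<partial>M) /\<^sub>R real (card (P n))"
        unfolding N_def
      proof (rule integral_uniform_random_index[OF M P, where B=1])
        fix k assume "k \<in> P n"
        then obtain i j where "k = (i, j)" "1 \<le> i" "1 \<le> j" by (auto simp: P_def)
        then show "(\<lambda>\<omega>. iexp (a * U (k, \<omega>) + b * V (k, \<omega>))) \<in> borel_measurable M"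
          using Xm[of i] Xm[of j] by (simp add: U_def V_def)
      qed simp
      also have "\<dots> = sum h (P n) /\<^sub>R r\<^sup>2"
        unfolding card_r h_def by (simp only: U_def V_def split_def fst_conv snd_conv)
      also have "\<dots> - ?g = (\<Sum>k\<in>P n. h k - ?g) /\<^sub>R r\<^sup>2"
        unfolding sum_subtractf sum_constant_scaleR card_r scaleR_diff_right using r by simp
      also have "cmod \<dots> = cmod (\<Sum>k\<in>P n. h k - ?g) / r\<^sup>2"
        by (simp add: divide_inverse_commute)
      also have "\<dots> \<le> (\<Sum>k\<in>P n. cmod (h k - ?g)) / r\<^sup>2"
        by (intro divide_right_mono norm_sum) simp
      also have "\<dots> \<le> (\<Sum>(i, j)\<in>P n. \<bar>a * b\<bar> * \<bar>covariance M (X i) (X j)\<bar>) / r\<^sup>2"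
      proof (intro divide_right_mono sum_mono)
        fix k assume "k \<in> P n"
        then obtain i j where "k = (i, j)" "1 \<le> i" "1 \<le> j" by (auto simp: P_def)
        then show "cmod (h k - ?g) \<le> (case k of (i, j) \<Rightarrow> \<bar>a * b\<bar> * \<bar>covariance M (X i) (X j)\<bar>)"
          using joint_char_close_to_product[OF M X, of i j a b] by (simp only: h_def prod.case)
      qed simp
      also have "(\<Sum>(i, j)\<in>P n. \<bar>a * b\<bar> * \<bar>covariance M (X i) (X j)\<bar>)
          = \<bar>a * b\<bar> * (\<Sum>(i, j)\<in>P n. \<bar>covariance M (X i) (X j)\<bar>)"
        by (simp only: sum_distrib_left split_def)
      also have "(\<Sum>(i, j)\<in>P n. \<bar>covariance M (X i) (X j)\<bar>) = r + dependence_measure M X (Suc n)"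
        unfolding P_def r_def by (rule sum_abs_covariance_eq[OF X])
      also have "\<bar>a * b\<bar> * (r + dependence_measure M X (Suc n)) / r\<^sup>2
          = \<bar>a * b\<bar> * (1 / r + dependence_measure M X (Suc n) / r\<^sup>2)"
        using r by (simp add: add_divide_distrib power2_eq_square distrib_left)
      finally show ?thesis unfolding r_def .
    qed
    have "(\<lambda>n. \<bar>a * b\<bar> * (1 / real (Suc n) + dependence_measure M X (Suc n) / (real (Suc n))\<^sup>2))
        \<longlonglongrightarrow> \<bar>a * b\<bar> * (0 + 0)"
      by (intro tendsto_intros LIMSEQ_Suc[OF lim_1_over_n] LIMSEQ_Suc[OF dep])
    then have "(\<lambda>n. (\<integral>z. iexp (a * U z + b * V z) \<partial>N n) - ?g) \<longlonglongrightarrow> 0"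
      by (intro Lim_null_comparison[OF always_eventually, rule_format, OF bound]) simp
    then show ?thesis by (simp add: LIM_zero_iff)
  qed
  then have "(\<lambda>n. \<integral>z. indicator {..x} (U z) * indicator {..y} (V z) \<partial>N n)
      \<longlonglongrightarrow> cdf std_normal_distribution x * cdf std_normal_distribution y"
    by (intro joint_levy_continuity[OF N_prob real_dist_normal_dist real_dist_normal_dist Um Vm _ x y])
  also have "(\<lambda>n. \<integral>z. indicator {..x} (U z) * indicator {..y} (V z) \<partial>N n :: real)
     = (\<lambda>n. (\<Sum>(i, j)\<in>P n. \<integral>\<omega>. indicator {..x} (X i \<omega>) * indicator {..y} (X j \<omega>) \<partial>M)
      / (real (Suc n))\<^sup>2)"
  proof
    fix n
    have "(\<integral>z. indicator {..x} (U z) * indicator {..y} (V z) \<partial>N n :: real)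
      = (\<Sum>k\<in>P n. \<integral>\<omega>. indicator {..x} (U (k, \<omega>)) * indicator {..y} (V (k, \<omega>)) \<partial>M)
        /\<^sub>R real (card (P n))"
      unfolding N_def
    proof (rule integral_uniform_random_index[OF M P, where B=1])
      fix k assume "k \<in> P n"
      then obtain i j where k: "k = (i, j)" "1 \<le> i" "1 \<le> j" by (auto simp: P_def)
      note [measurable] = Xm[OF k(2)] Xm[OF k(3)]
      show "(\<lambda>\<omega>. indicator {..x} (U (k, \<omega>)) * indicator {..y} (V (k, \<omega>)) :: real) \<in> borel_measurable M"
        unfolding k U_def V_def by simp
    qed (auto split: split_indicator)
    then show "(\<integral>z. indicator {..x} (U z) * indicator {..y} (V z) \<partial>N n :: real)
      = (\<Sum>(i, j)\<in>P n. \<integral>\<omega>. indicator {..x} (X i \<omega>) * indicator {..y} (X j \<omega>) \<partial>M) / (real (Suc n))\<^sup>2"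
      unfolding card_P by (simp add: U_def V_def split_def divide_inverse_commute del: of_nat_Suc)
  qed
  finally show ?thesis
    unfolding P_def by (rule LIMSEQ_imp_Suc)
qed

section \<open>Elementary properties of the empirical distribution\<close>

lemma isCont_std_normal_cdf: "isCont std_normal_cdf x"
proof -
  interpret real_distribution std_normal_distribution by (rule real_dist_normal_dist)
  have "emeasure std_normal_distribution {x} = 0"
    by (subst emeasure_density) auto
  then show ?thesis
    unfolding std_normal_cdf_def isCont_cdf by (simp add: measure_def)
qed

text \<open>This translates the event $\Phi(X_i)\le t$ into $X_i\le y$; the point \<open>y\<close> is the largest one with
$\Phi(y)=t$.\<close>
lemma std_normal_cdf_sublevel:
  assumes "0 < t" "t < 1"
  obtains y where "std_normal_cdf y = t" "{x. std_normal_cdf x \<le> t} = {..y}"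
proof -
  interpret real_distribution std_normal_distribution by (rule real_dist_normal_dist)
  let ?F = std_normal_cdf
  have F: "?F = cdf std_normal_distribution" by (simp add: std_normal_cdf_def)
  have mono: "x \<le> y \<Longrightarrow> ?F x \<le> ?F y" for x y unfolding F by (rule cdf_nondecreasing)
  have cont: "continuous_on S ?F" for S
    using isCont_std_normal_cdf by (auto intro: continuous_at_imp_continuous_on)
  have "eventually (\<lambda>x. ?F x < t) at_bot" "eventually (\<lambda>x. t < ?F x) at_top"
    unfolding F using assms
    by (auto intro: order_tendstoD[OF cdf_lim_at_bot] order_tendstoD[OF cdf_lim_at_top_prob])
  then obtain a b where a: "?F a < t" and b: "t < ?F b"
    by (auto simp: eventually_at_bot_linorder eventually_at_top_linorder)
  let ?S = "{x. ?F x \<le> t}"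
  have "closed ?S" using closed_Collect_le[OF cont continuous_on_const] by simp
  moreover have ne: "?S \<noteq> {}" using a by (auto intro: less_imp_le)
  moreover have bdd: "bdd_above ?S"
  proof (rule bdd_aboveI)
    fix x assume "x \<in> ?S"
    then show "x \<le> b" using b mono[of b x] by force
  qed
  ultimately have SupS: "Sup ?S \<in> ?S" by (rule closed_contains_Sup[rotated -1]) 
  define y where "y = Sup ?S"
  have S: "?S = {..y}"
  proof safe
    fix x assume "?F x \<le> t" then show "x \<le> y" unfolding y_def by (intro cSup_upper bdd) auto
  next
    fix x assume "x \<le> y" then show "?F x \<le> t" using SupS mono[of x y] by (simp add: y_def)
  qed
  have "\<exists>x. a \<le> x \<and> x \<le> b \<and> ?F x = t"
    using a b mono[of b a] by (intro IVT' cont) (auto intro: less_imp_le le_cases[of a b])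
  then obtain x where "?F x = t" by blast
  then have "x \<in> {..y}" unfolding S[symmetric] by simp
  then have "?F y = t" using \<open>?F x = t\<close> SupS mono[of x y] by (simp add: y_def)
  then show ?thesis using that S by blast
qed

text \<open>The deterministic half of the classical Glivenko-Cantelli argument: between two neighbouring grid
points both functions are trapped in the same interval of length \<open>1 / m\<close>, up to the error \<open>d\<close>.
In the first and in the last cell the range bounds 0 and 1 serve at the outer end point.\<close>
lemma grid_bound_monotone:
  fixes f g :: "real \<Rightarrow> real"
  assumes f: "mono f" "\<And>t. 0 \<le> f t" "\<And>t. f t \<le> 1" and g: "mono g" "\<And>t. 0 \<le> g t" "\<And>t. g t \<le> 1"
    and outside: "\<And>t. t < 0 \<or> 1 \<le> t \<Longrightarrow> f t = g t"
    and m: "0 < m" and d: "0 \<le> d"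
    and f_grid: "\<And>k. 0 < k \<Longrightarrow> k < m \<Longrightarrow> \<bar>f (real k / real m) - real k / real m\<bar> \<le> d"
    and g_grid: "\<And>k. 0 < k \<Longrightarrow> k < m \<Longrightarrow> g (real k / real m) = real k / real m"
  shows "\<bar>f t - g t\<bar> \<le> d + 1 / real m"
proof (cases "0 \<le> t \<and> t < 1")
  case True
  define k where "k = nat \<lfloor>real m * t\<rfloor>"
  have rk: "real k = of_int \<lfloor>real m * t\<rfloor>" using True by (simp add: k_def)
  have k1: "real k \<le> real m * t" and k2: "real m * t < real k + 1" unfolding rk by linarith+
  have "real m * t < real m" using True m by simp
  then have km: "k < m" using k1 by simp
  have lo: "real k / real m \<le> t" using k1 m by (simp add: field_simps)
  have hi: "t \<le> real (Suc k) / real m" using k2 m by (simp add: field_simps)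
  have between: "real k / real m - e \<le> h t \<and> h t \<le> real (Suc k) / real m + e"
    if h: "mono h" "\<And>t. 0 \<le> h t" "\<And>t. h t \<le> 1" and "0 \<le> e"
      and grid: "\<And>k. 0 < k \<Longrightarrow> k < m \<Longrightarrow> \<bar>h (real k / real m) - real k / real m\<bar> \<le> e" for h :: "real \<Rightarrow> real" and e
  proof
    show "real k / real m - e \<le> h t"
    proof (cases "k = 0")
      case True then show ?thesis using h(2)[of t] \<open>0 \<le> e\<close> by simp
    next
      case False
      then show ?thesis using grid[of k] km monoD[OF h(1) lo] by simp
    qed
    show "h t \<le> real (Suc k) / real m + e"
    proof (cases "Suc k = m")
      case True then show ?thesis using h(3)[of t] \<open>0 \<le> e\<close> m by (simp del: of_nat_Suc)
    next
      case False
      then show ?thesis using grid[of "Suc k"] km monoD[OF h(1) hi] by (simp del: of_nat_Suc)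
    qed
  qed
  have "real (Suc k) / real m = real k / real m + 1 / real m" by (simp add: add_divide_distrib)
  then show ?thesis
    using between[OF f d f_grid] between[OF g order_refl, simplified] g_grid by (auto simp: abs_le_iff)
next
  case False
  then have "f t = g t" by (intro outside) auto
  then show ?thesis using d by simp
qed

lemma empirical_distribution_mono: "mono (\<lambda>t. empirical_distribution X n t \<omega>)"
  unfolding empirical_distribution_def
  by (intro monoI divide_right_mono sum_mono) auto

lemma empirical_distribution_nonneg: "0 \<le> empirical_distribution X n t \<omega>"
  unfolding empirical_distribution_def by (intro divide_nonneg_nonneg sum_nonneg) auto

lemma empirical_distribution_le_1: "empirical_distribution X n t \<omega> \<le> 1"
proof -
  have "(\<Sum>i=1..n. of_bool (std_normal_cdf (X i \<omega>) \<le> t) :: real) \<le> (\<Sum>i=1..n. 1)"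
    by (rule sum_mono) auto
  then show ?thesis
    by (simp add: empirical_distribution_def divide_le_eq_1 del: sum_of_bool_eq) linarith
qed

lemma empirical_distribution_outside_unit_interval:
  "t < 0 \<Longrightarrow> empirical_distribution X n t \<omega> = 0"
  "1 \<le> t \<Longrightarrow> 0 < n \<Longrightarrow> empirical_distribution X n t \<omega> = 1"
proof -
  interpret real_distribution std_normal_distribution by (rule real_dist_normal_dist)
  have F: "0 \<le> std_normal_cdf x" "std_normal_cdf x \<le> 1" for x
    unfolding std_normal_cdf_def by (rule cdf_nonneg cdf_bounded_prob)+
  show "empirical_distribution X n t \<omega> = 0" if "t < 0"
    using less_le_trans[OF that F(1)] by (simp add: empirical_distribution_def not_le[symmetric])
  show "empirical_distribution X n t \<omega> = 1" if "1 \<le> t" "0 < n"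
    using that order_trans[OF F(2) that(1)] by (simp add: empirical_distribution_def)
qed

lemma empirical_distribution_right_continuous:
  "((\<lambda>s. empirical_distribution X n s \<omega>) \<longlongrightarrow> empirical_distribution X n t \<omega>) (at_right t)"
proof -
  have "((\<lambda>s. of_bool (c \<le> s) :: real) \<longlongrightarrow> of_bool (c \<le> t)) (at_right t)" for c :: real
  proof (cases "c \<le> t")
    case True
    have "eventually (\<lambda>s. of_bool (c \<le> s) = (of_bool (c \<le> t) :: real)) (at_right t)"
      using eventually_at_right_less[of t] by eventually_elim (use True in auto)
    then show ?thesis by (rule tendsto_eventually)
  next
    case False
    have "eventually (\<lambda>s. of_bool (c \<le> s) = (of_bool (c \<le> t) :: real)) (at_right t)"
      using eventually_at_right_real[of t c] False by (auto elim!: eventually_mono)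
    then show ?thesis by (rule tendsto_eventually)
  qed
  then show ?thesis
    unfolding empirical_distribution_def divide_inverse by (intro tendsto_mult tendsto_sum tendsto_const)
qed

lemma borel_measurable_std_normal_cdf [measurable]: "std_normal_cdf \<in> borel_measurable borel"
  by (intro borel_measurable_continuous_onI continuous_at_imp_continuous_on) (simp add: isCont_std_normal_cdf)

lemma empirical_distribution_measurable:
  assumes "standardized_gaussian_process M X"
  shows "empirical_distribution X n t \<in> borel_measurable M"
proof -
  have [measurable]: "X i \<in> borel_measurable M" if "i \<in> {1..n}" for i
    using standardized_gaussian_process_measurable[OF assms] that by simp
  show ?thesis unfolding empirical_distribution_def[abs_def] by measurable
qed


lemma expectation_empirical_distribution:
  assumes M: "prob_space M" and X: "standardized_gaussian_process M X" and n: "0 < n"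
    and t: "0 < t" "t < 1"
  shows "(\<integral>\<omega>. empirical_distribution X n t \<omega> \<partial>M) = t"
proof -
  interpret prob_space M by (rule M)
  obtain y where y: "std_normal_cdf y = t" "{x. std_normal_cdf x \<le> t} = {..y}"
    using std_normal_cdf_sublevel[OF t] .
  have prob: "(\<integral>\<omega>. of_bool (std_normal_cdf (X i \<omega>) \<le> t) \<partial>M) = t" 
    and intable: "integrable M (\<lambda>\<omega>. of_bool (std_normal_cdf (X i \<omega>) \<le> t) :: real)" if "1 \<le> i" for i
  proof -
    note [measurable] = standardized_gaussian_process_measurable[OF X that]
    have "(\<integral>\<omega>. of_bool (std_normal_cdf (X i \<omega>) \<le> t) \<partial>M) = (\<integral>\<omega>. indicator {..y} (X i \<omega>) \<partial>M :: real)"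
      using y(2) by (intro Bochner_Integration.integral_cong) (auto simp: indicator_def)
    also have "\<dots> = (\<integral>x. indicator {..y} x \<partial>distr M borel (X i))"
      by (rule integral_distr[symmetric]) measurable
    also have "\<dots> = cdf (distr M borel (X i)) y" by (simp add: cdf_def)
    also have "\<dots> = t"
      using X that y(1) by (simp add: standardized_gaussian_process_def std_normal_cdf_def)
    finally show "(\<integral>\<omega>. of_bool (std_normal_cdf (X i \<omega>) \<le> t) \<partial>M) = t" .
    show "integrable M (\<lambda>\<omega>. of_bool (std_normal_cdf (X i \<omega>) \<le> t) :: real)"
      by (rule integrable_const_bound[where B=1]) auto
  qed
  have "(\<integral>\<omega>. empirical_distribution X n t \<omega> \<partial>M)
    = (\<Sum>i=1..n. \<integral>\<omega>. of_bool (std_normal_cdf (X i \<omega>) \<le> t) \<partial>M) / real n"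
    unfolding empirical_distribution_def
    by (subst integral_divide_zero, subst Bochner_Integration.integral_sum) (use intable in auto)
  also have "\<dots> = t" using prob n by simp
  finally show ?thesis .
qed

section \<open>Uniform convergence in probability\<close>

text \<open>Expanding the square, the second moment of the empirical distribution at \<open>t\<close> is the average of the
joint probabilities of all pairs, which tends to \<open>t\<^sup>2\<close>. Hence the variance tends to 0, and Chebyshev's
inequality applies.\<close>
lemma empirical_distribution_concentrates:
  assumes M: "prob_space M" and X: "standardized_gaussian_process M X"
    and dep: "(\<lambda>n. dependence_measure M X n / real n ^ 2) \<longlonglongrightarrow> 0"
    and t: "0 < t" "t < 1" and d: "0 < d"
  shows "(\<lambda>n. measure M {\<omega> \<in> space M. d \<le> \<bar>empirical_distribution X n t \<omega> - t\<bar>}) \<longlonglongrightarrow> 0"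
proof -
  interpret prob_space M by (rule M)
  let ?F = "\<lambda>n. empirical_distribution X n t"
  obtain y where y: "std_normal_cdf y = t" "{x. std_normal_cdf x \<le> t} = {..y}"
    using std_normal_cdf_sublevel[OF t] .
  note Xm = standardized_gaussian_process_measurable[OF X]
  note [measurable] = empirical_distribution_measurable[OF X]
  have F_abs: "\<bar>?F n \<omega>\<bar> \<le> 1" for n \<omega>
    using empirical_distribution_nonneg[of X n t \<omega>] empirical_distribution_le_1[of X n t \<omega>] by simp
  have F_int: "integrable M (?F n)" for n
    by (rule integrable_const_bound[where B=1]) (use F_abs in auto)
  have F2_int: "integrable M (\<lambda>\<omega>. (?F n \<omega>)\<^sup>2)" for n
    by (rule integrable_const_bound[where B=1]) (use F_abs in \<open>auto simp: abs_square_le_1\<close>)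
  have second_moment: "(\<integral>\<omega>. (?F n \<omega>)\<^sup>2 \<partial>M)
    = (\<Sum>(i, j)\<in>{1..n} \<times> {1..n}. \<integral>\<omega>. indicator {..y} (X i \<omega>) * indicator {..y} (X j \<omega>) \<partial>M) / (real n)\<^sup>2"
    for n
  proof -
    have F_eq: "?F n \<omega> = (\<Sum>i=1..n. indicator {..y} (X i \<omega>)) / real n" for \<omega>
      unfolding empirical_distribution_def using y(2)
      by (intro arg_cong2[where f="(/)"] sum.cong) (auto simp: indicator_def)
    have "(\<integral>\<omega>. (?F n \<omega>)\<^sup>2 \<partial>M)
      = (\<integral>\<omega>. (\<Sum>k\<in>{1..n} \<times> {1..n}. indicator {..y} (X (fst k) \<omega>) * indicator {..y} (X (snd k) \<omega>)) / (real n)\<^sup>2 \<partial>M)"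
      by (simp only: F_eq power2_eq_square times_divide_times_eq sum_product sum.cartesian_product split_def)
    also have "\<dots> = (\<Sum>k\<in>{1..n} \<times> {1..n}. \<integral>\<omega>. indicator {..y} (X (fst k) \<omega>) * indicator {..y} (X (snd k) \<omega>) \<partial>M) / (real n)\<^sup>2"
    proof (subst integral_divide_zero, subst Bochner_Integration.integral_sum)
      fix k assume "k \<in> {1..n} \<times> {1..n}"
      then have [measurable]: "X (fst k) \<in> borel_measurable M" "X (snd k) \<in> borel_measurable M"
        using Xm by auto
      show "integrable M (\<lambda>\<omega>. indicator {..y} (X (fst k) \<omega>) * indicator {..y} (X (snd k) \<omega>) :: real)"
        by (rule integrable_const_bound[where B=1]) (auto split: split_indicator)
    qed simp
    finally show ?thesis by (simp add: split_def)
  qed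
  have "(\<lambda>n. \<integral>\<omega>. (?F n \<omega>)\<^sup>2 \<partial>M) \<longlonglongrightarrow> t * t"
    unfolding second_moment
    using asymptotic_pairwise_independence[OF M X dep, of y y] isCont_std_normal_cdf[of y] y(1)
    by (simp add: std_normal_cdf_def)
  then have "(\<lambda>n. ((\<integral>\<omega>. (?F n \<omega>)\<^sup>2 \<partial>M) - t\<^sup>2) / d\<^sup>2) \<longlonglongrightarrow> (t * t - t\<^sup>2) / d\<^sup>2"
    by (intro tendsto_intros) (use d in auto)
  then have lim: "(\<lambda>n. ((\<integral>\<omega>. (?F n \<omega>)\<^sup>2 \<partial>M) - t\<^sup>2) / d\<^sup>2) \<longlonglongrightarrow> 0"
    by (simp add: power2_eq_square)
  have "measure M {\<omega> \<in> space M. d \<le> \<bar>?F n \<omega> - t\<bar>} \<le> ((\<integral>\<omega>. (?F n \<omega>)\<^sup>2 \<partial>M) - t\<^sup>2) / d\<^sup>2"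
    if "0 < n" for n
    using Chebyshev_inequality[OF _ F2_int[of n] d] variance_eq[OF F_int F2_int, of n]
      expectation_empirical_distribution[OF M X that t] by simp
  then have "eventually (\<lambda>n. measure M {\<omega> \<in> space M. d \<le> \<bar>?F n \<omega> - t\<bar>}
      \<le> ((\<integral>\<omega>. (?F n \<omega>)\<^sup>2 \<partial>M) - t\<^sup>2) / d\<^sup>2) sequentially"
    by (rule eventually_mono[OF eventually_gt_at_top[of 0]])
  then show ?thesis
    by (intro tendsto_sandwich[OF _ _ tendsto_const lim]) auto
qed

text \<open>Reduces the supremum over all real \<open>t\<close> to a countable one, which makes it a random variable.\<close>
lemma SUP_rationals_right_continuous:
  fixes h :: "real \<Rightarrow> real"
  assumes right_cont: "\<And>t. (h \<longlongrightarrow> h t) (at_right t)" and bdd: "bdd_above (range h)"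
  shows "(SUP t. h t) = (SUP q\<in>\<rat>. h q)"
proof (rule antisym)
  have bddQ: "bdd_above (h ` \<rat>)" by (rule bdd_above_mono[OF bdd]) auto
  show "(SUP q\<in>\<rat>. h q) \<le> (SUP t. h t)"
    by (rule cSUP_subset_mono[OF _ bdd]) (auto intro: Rats_0)
  show "(SUP t. h t) \<le> (SUP q\<in>\<rat>. h q)"
  proof (rule cSUP_least)
    fix t
    show "h t \<le> (SUP q\<in>\<rat>. h q)"
    proof (rule ccontr)
      assume "\<not> h t \<le> (SUP q\<in>\<rat>. h q)"
      then have "eventually (\<lambda>s. (SUP q\<in>\<rat>. h q) < h s) (at_right t)"
        by (intro order_tendstoD(1)[OF right_cont]) simp
      then obtain b where b: "t < b" "\<And>s. t < s \<Longrightarrow> s < b \<Longrightarrow> (SUP q\<in>\<rat>. h q) < h s"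
        unfolding eventually_at_right_field by blast
      obtain q where "q \<in> \<rat>" "t < q" "q < b" using Rats_dense_in_real[OF b(1)] by blast
      then have "(SUP q\<in>\<rat>. h q) < h q" "h q \<le> (SUP q\<in>\<rat>. h q)"
        using b(2) by (auto intro: cSUP_upper bddQ)
      then show False by simp
    qed
  qed simp
qed

lemma expectation_empirical_distribution_right_continuous:
  assumes M: "prob_space M" and X: "standardized_gaussian_process M X"
  shows "((\<lambda>s. \<integral>\<omega>. empirical_distribution X n s \<omega> \<partial>M) \<longlongrightarrow> (\<integral>\<omega>. empirical_distribution X n t \<omega> \<partial>M)) (at_right t)"
proof (rule tendsto_at_right_sequentially[of t "t + 1"])
  interpret prob_space M by (rule M)
  fix S :: "nat \<Rightarrow> real"
  assume S: "\<And>m. t < S m" "S \<longlonglongrightarrow> t"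
  have S_right: "filterlim S (at_right t) sequentially"
    by (rule tendsto_imp_filterlim_at_right[OF S(2)]) (use S(1) in auto)
  show "(\<lambda>m. \<integral>\<omega>. empirical_distribution X n (S m) \<omega> \<partial>M) \<longlonglongrightarrow> (\<integral>\<omega>. empirical_distribution X n t \<omega> \<partial>M)"
  proof (rule integral_dominated_convergence[where w="\<lambda>_. 1"])
    show "AE \<omega> in M. (\<lambda>m. empirical_distribution X n (S m) \<omega>) \<longlonglongrightarrow> empirical_distribution X n t \<omega>"
      by (intro AE_I2 filterlim_compose[OF empirical_distribution_right_continuous S_right])
    show "AE \<omega> in M. norm (empirical_distribution X n (S m) \<omega>) \<le> 1" for m
      by (simp add: empirical_distribution_nonneg empirical_distribution_le_1)
  qed (use empirical_distribution_measurable[OF X] in auto)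
qed simp

theorem theorem1:
  fixes M :: "'a measure" and X :: "nat \<Rightarrow> 'a \<Rightarrow> real"
  assumes "prob_space M"
    and "standardized_gaussian_process M X"
    and "(\<lambda>n. dependence_measure M X n / real n ^ 2) \<longlonglongrightarrow> 0"
  shows "converges_in_probability M
    (\<lambda>n \<omega>. SUP t\<in>(UNIV :: real set).
       \<bar>empirical_distribution X n t \<omega> - (\<integral>\<omega>'. empirical_distribution X n t \<omega>' \<partial>M)\<bar>)
    (\<lambda>_. 0)"
proof -
  interpret prob_space M by (rule assms(1))
  define G where "G n t = (\<integral>\<omega>. empirical_distribution X n t \<omega> \<partial>M)" for n t
  define H where "H n \<omega> t = \<bar>empirical_distribution X n t \<omega> - G n t\<bar>" for n \<omega> t
  note Fm [measurable] = empirical_distribution_measurable[OF assms(2)]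
  have F_int: "integrable M (empirical_distribution X n t)" for n t
    by (rule integrable_const_bound[where B=1])
       (auto simp: empirical_distribution_nonneg empirical_distribution_le_1)
  have G_mono: "mono (G n)" for n
    unfolding G_def by (intro monoI integral_mono F_int) (rule monoD[OF empirical_distribution_mono])
  have G_nonneg: "0 \<le> G n t" for n t
    unfolding G_def by (rule Bochner_Integration.integral_nonneg) (rule empirical_distribution_nonneg)
  have G_le_1: "G n t \<le> 1" for n t
    unfolding G_def by (rule integral_le_const[OF F_int]) (simp add: empirical_distribution_le_1)
  have G_outside: "empirical_distribution X n t \<omega> = G n t" if "0 < n" "t < 0 \<or> 1 \<le> t" for n t \<omega>
    using that by (auto simp: G_def empirical_distribution_outside_unit_interval prob_space)
  have H_le_1: "H n \<omega> t \<le> 1" for n \<omega> t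
    using empirical_distribution_nonneg[of X n t \<omega>] empirical_distribution_le_1[of X n t \<omega>]
      G_nonneg[of n t] G_le_1[of n t] by (simp add: H_def abs_le_iff)
  have H_bdd: "bdd_above (H n \<omega> ` T)" for n \<omega> T
    by (rule bdd_aboveI2[where M=1]) (rule H_le_1)
  have H_SUP: "(SUP t. H n \<omega> t) = (SUP q\<in>\<rat>. H n \<omega> q)" for n \<omega>
    unfolding H_def G_def
    by (intro SUP_rationals_right_continuous tendsto_intros empirical_distribution_right_continuous
        expectation_empirical_distribution_right_continuous assms)
       (use H_bdd in \<open>simp add: H_def G_def\<close>)
  have meas: "(\<lambda>\<omega>. SUP t. H n \<omega> t) \<in> borel_measurable M" for n
    unfolding H_SUP
  proof (rule borel_measurable_cSUP[OF countable_rat])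
    show "(\<lambda>\<omega>. H n \<omega> q) \<in> borel_measurable M" for q
      unfolding H_def by measurable
  qed (rule H_bdd)
  have "(\<lambda>n. prob {\<omega> \<in> space M. \<epsilon> < \<bar>(SUP t. H n \<omega> t) - 0\<bar>}) \<longlonglongrightarrow> 0" if "0 < \<epsilon>" for \<epsilon>
  proof -
    \<comment> \<open>Half of \<open>\<epsilon>\<close> pays for the mesh of the grid, the other half for the deviations at its points.\<close>
    obtain m :: nat where m: "0 < m" "1 / real m < \<epsilon> / 2"
      using real_arch_inverse[of "\<epsilon> / 2"] \<open>0 < \<epsilon>\<close> by (auto simp: inverse_eq_divide)
    define B where "B n k = {\<omega> \<in> space M. \<epsilon> / 2 \<le> \<bar>empirical_distribution X n (real k / real m) \<omega> - real k / real m\<bar>}" for n k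
    have B_meas: "B n k \<in> events" for n k unfolding B_def by measurable
    have "(\<lambda>n. \<Sum>k\<in>{0<..<m}. prob (B n k)) \<longlonglongrightarrow> (\<Sum>k\<in>{0<..<m}. 0)"
      unfolding B_def
      by (intro tendsto_sum empirical_distribution_concentrates assms) (use \<open>0 < \<epsilon>\<close> in auto)
    then have lim: "(\<lambda>n. \<Sum>k\<in>{0<..<m}. prob (B n k)) \<longlonglongrightarrow> 0" by simp
    have "prob {\<omega> \<in> space M. \<epsilon> < \<bar>(SUP t. H n \<omega> t) - 0\<bar>} \<le> (\<Sum>k\<in>{0<..<m}. prob (B n k))"
      if n: "0 < n" for n
    proof -
      have "{\<omega> \<in> space M. \<epsilon> < \<bar>(SUP t. H n \<omega> t) - 0\<bar>} \<subseteq> (\<Union>k\<in>{0<..<m}. B n k)"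
      proof (rule ccontr)
        assume "\<not> ?thesis"
        then obtain \<omega> where \<omega>: "\<epsilon> < \<bar>(SUP t. H n \<omega> t) - 0\<bar>"
          and good: "\<And>k. 0 < k \<Longrightarrow> k < m \<Longrightarrow>
            \<bar>empirical_distribution X n (real k / real m) \<omega> - real k / real m\<bar> \<le> \<epsilon> / 2"
          by (fastforce simp: B_def)
        have "H n \<omega> t \<le> \<epsilon>" for t
        proof -
          have "H n \<omega> t \<le> \<epsilon> / 2 + 1 / real m"
            unfolding H_def
          proof (rule grid_bound_monotone[OF empirical_distribution_mono empirical_distribution_nonneg
                empirical_distribution_le_1 G_mono G_nonneg G_le_1 G_outside[OF n] m(1) _ good])
            show "G n (real k / real m) = real k / real m" if "0 < k" "k < m" for k
              unfolding G_def using that n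
              by (intro expectation_empirical_distribution assms) auto
          qed (use \<open>0 < \<epsilon>\<close> in auto)
          then show ?thesis using m(2) by simp
        qed
        then have "(SUP t. H n \<omega> t) \<le> \<epsilon>" by (intro cSUP_least) auto
        moreover have "0 \<le> (SUP t. H n \<omega> t)"
          by (rule cSUP_upper2[OF H_bdd, of 0]) (simp_all add: H_def)
        ultimately show False using \<omega> by simp
      qed
      then have "prob {\<omega> \<in> space M. \<epsilon> < \<bar>(SUP t. H n \<omega> t) - 0\<bar>} \<le> prob (\<Union>k\<in>{0<..<m}. B n k)"
        by (rule finite_measure_mono) (use B_meas in auto)
      also have "\<dots> \<le> (\<Sum>k\<in>{0<..<m}. prob (B n k))"
        by (rule finite_measure_subadditive_finite) (use B_meas in auto)
      finally show ?thesis .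
    qed
    then have "eventually (\<lambda>n. prob {\<omega> \<in> space M. \<epsilon> < \<bar>(SUP t. H n \<omega> t) - 0\<bar>}
        \<le> (\<Sum>k\<in>{0<..<m}. prob (B n k))) sequentially"
      by (rule eventually_mono[OF eventually_gt_at_top[of 0]])
    then show ?thesis
      by (intro tendsto_sandwich[OF _ _ tendsto_const lim]) auto
  qed
  then show ?thesis
    using meas unfolding converges_in_probability_def H_def G_def by simp
qed

end
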